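(* Let $(\gamma,\nu):I\to\Delta_1$ be a spacelike Legendre curve with curvature $(m,n)$ such that $\{t\in I:n(t)\ne0\}$ is dense in $I$, and let $s_\pm:I\to\mathbb R$ be a solution of the Riccati equation $\dot s_\pm=\frac{m\pm n}{2}s_\pm^2-m$. Define $H_I^\pm:I\times H^2\to\mathbb R$ by $$H_I^\pm(t,x)=\left\langle \gamma(t)\mp\mu(t)+s_\pm(t)\left(\mu(t)\mp\gamma(t)-\nu(t)\right)+\frac{s_\pm^2(t)}{2}(\gamma(t)\pm\nu(t)),\,x\right\rangle+1.$$ Suppose that $(s_\pm(t)\mp1)(n(t)\mp m(t))\neq0$ for all $t\in I$. Then the image of the horocyclic involute $Inv^\pm(\gamma,s_\pm)$ of $\gamma$ is the discriminant set of $H_I^\pm$.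
   Context: All maps are $C^\infty$; $I\subset\mathbb R$ is an interval; a dot denotes $d/dt$. In every formula with $\pm,\mp$ the upper signs are taken together and the lower signs together. $\mathbb R^3_1$ is $\mathbb R^3$ with $\langle x,y\rangle=-x_1y_1+x_2y_2+x_3y_3$ and $x\wedge y=(-(x_2y_3-x_3y_2),\,x_3y_1-x_1y_3,\,x_1y_2-x_2y_1)$. $H^2=\{x:\langle x,x\rangle=-1,\ x_1>0\}$, $S^2_1=\{x:\langle x,x\rangle=1\}$, $\Delta_1=\{(\nu_1,\nu_2)\in H^2\times S_1^2:\langle\nu_1,\nu_2\rangle=0\}$. A spacelike Legendre curve is a map $(\gamma,\nu):I\to\Delta_1$ with $\langle\dot\gamma,\nu\rangle=0$ on $I$; put $\mu=\gamma\wedge\nu$. Its curvature is the pair $(m,n)$ with $\dot\gamma=m\mu$, $\dot\nu=n\mu$ (then $\dot\mu=m\gamma-n\nu$). Horocyclic involute: $Inv^\pm(\gamma,s_\pm)(t)=\gamma(t)+s_\pm(t)\mu(t)+\frac{s_\pm^2(t)}{2}(\gamma(t)\pm\nu(t))$, where $s_\pm$ is a solution of the Riccati equation above. The discriminant set of a smooth function $F(t,x)$ on $I\times H^2$ is $\mathcal D_F=\{x\in H^2:\ \text{there exists } t\in I \text{ with } F(t,x)=\frac{\partial F}{\partial t}(t,x)=0\}$.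
   Formalization: The hypothesis is corrected from $(s_\pm\mp1)(n\mp m)\neq0$ to $(s_\pm\mp1)(n\pm m)\neq0$, since the printed sign makes the claim false (e.g. upper signs, $m=1$, $n=-1$, $s=-t$ on $(0,1)$). *)

theory Defs
  imports "HOL-Analysis.Analysis"
begin

definition lorentz :: "real ^ 3 \<Rightarrow> real ^ 3 \<Rightarrow> real" where
  "lorentz x y = - (x $ 1 * y $ 1) + x $ 2 * y $ 2 + x $ 3 * y $ 3"

definition lorentz_wedge :: "real ^ 3 \<Rightarrow> real ^ 3 \<Rightarrow> real ^ 3" where
  "lorentz_wedge x y = vector
     [- (x $ 2 * y $ 3 - x $ 3 * y $ 2),
      x $ 3 * y $ 1 - x $ 1 * y $ 3,
      x $ 1 * y $ 2 - x $ 2 * y $ 1]"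

definition hyperbolic_plane :: "(real ^ 3) set" where
  "hyperbolic_plane = {x. lorentz x x = -1 \<and> x $ 1 > 0}"

definition de_Sitter :: "(real ^ 3) set" where
  "de_Sitter = {x. lorentz x x = 1}"

definition Delta1 :: "((real ^ 3) \<times> (real ^ 3)) set" where
  "Delta1 = {(x, y). x \<in> hyperbolic_plane \<and> y \<in> de_Sitter \<and> lorentz x y = 0}"

text \<open>The functions \<open>D k\<close> are the successive derivatives. They are taken within the set,
  hence one-sided at an endpoint of an interval that belongs to it.\<close>

definition smooth_on :: "real set \<Rightarrow> (real \<Rightarrow> 'a::real_normed_vector) \<Rightarrow> bool" where
  "smooth_on I f \<longleftrightarrow>
     (\<exists>D :: nat \<Rightarrow> real \<Rightarrow> 'a.
        (\<forall>t\<in>I. D 0 t = f t) \<and>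
        (\<forall>k. \<forall>t\<in>I. (D k has_vector_derivative D (Suc k) t) (at t within I)))"

definition spacelike_Legendre_curve ::
  "real set \<Rightarrow> (real \<Rightarrow> real ^ 3) \<Rightarrow> (real \<Rightarrow> real ^ 3) \<Rightarrow> bool" where
  "spacelike_Legendre_curve I \<gamma> \<nu> \<longleftrightarrow>
     smooth_on I \<gamma> \<and> smooth_on I \<nu> \<and>
     (\<forall>t\<in>I. (\<gamma> t, \<nu> t) \<in> Delta1) \<and>
     (\<forall>t\<in>I. lorentz (vector_derivative \<gamma> (at t within I)) (\<nu> t) = 0)"

definition frame_mu :: "(real \<Rightarrow> real ^ 3) \<Rightarrow> (real \<Rightarrow> real ^ 3) \<Rightarrow> real \<Rightarrow> real ^ 3" where
  "frame_mu \<gamma> \<nu> t = lorentz_wedge (\<gamma> t) (\<nu> t)"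

definition Legendre_curvature ::
  "real set \<Rightarrow> (real \<Rightarrow> real ^ 3) \<Rightarrow> (real \<Rightarrow> real ^ 3) \<Rightarrow> (real \<Rightarrow> real) \<Rightarrow> (real \<Rightarrow> real) \<Rightarrow> bool" where
  "Legendre_curvature I \<gamma> \<nu> m n \<longleftrightarrow>
     (\<forall>t\<in>I. (\<gamma> has_vector_derivative m t *\<^sub>R frame_mu \<gamma> \<nu> t) (at t within I)) \<and>
     (\<forall>t\<in>I. (\<nu> has_vector_derivative n t *\<^sub>R frame_mu \<gamma> \<nu> t) (at t within I))"

text \<open>In the following definitions the parameter \<open>\<sigma>\<close> is \<open>1\<close> for the upper signs of a formula
  with \<open>\<plusminus>\<close> and \<open>\<mp>\<close>, and \<open>-1\<close> for the lower signs.\<close>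

definition Riccati_solution ::
  "real \<Rightarrow> real set \<Rightarrow> (real \<Rightarrow> real) \<Rightarrow> (real \<Rightarrow> real) \<Rightarrow> (real \<Rightarrow> real) \<Rightarrow> bool" where
  "Riccati_solution \<sigma> I m n s \<longleftrightarrow>
     smooth_on I s \<and>
     (\<forall>t\<in>I. (s has_real_derivative ((m t + \<sigma> * n t) / 2 * (s t)\<^sup>2 - m t)) (at t within I))"

definition horocyclic_involute ::
  "real \<Rightarrow> (real \<Rightarrow> real ^ 3) \<Rightarrow> (real \<Rightarrow> real ^ 3) \<Rightarrow> (real \<Rightarrow> real) \<Rightarrow> real \<Rightarrow> real ^ 3" where
  "horocyclic_involute \<sigma> \<gamma> \<nu> s t =
     \<gamma> t + s t *\<^sub>R frame_mu \<gamma> \<nu> t + ((s t)\<^sup>2 / 2) *\<^sub>R (\<gamma> t + \<sigma> *\<^sub>R \<nu> t)"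

definition H_I ::
  "real \<Rightarrow> (real \<Rightarrow> real ^ 3) \<Rightarrow> (real \<Rightarrow> real ^ 3) \<Rightarrow> (real \<Rightarrow> real) \<Rightarrow> real \<Rightarrow> real ^ 3 \<Rightarrow> real" where
  "H_I \<sigma> \<gamma> \<nu> s t x =
     lorentz
       (\<gamma> t - \<sigma> *\<^sub>R frame_mu \<gamma> \<nu> t
        + s t *\<^sub>R (frame_mu \<gamma> \<nu> t - \<sigma> *\<^sub>R \<gamma> t - \<nu> t)
        + ((s t)\<^sup>2 / 2) *\<^sub>R (\<gamma> t + \<sigma> *\<^sub>R \<nu> t)) x
     + 1"

definition discriminant_set :: "real set \<Rightarrow> (real \<Rightarrow> real ^ 3 \<Rightarrow> real) \<Rightarrow> (real ^ 3) set" where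
  "discriminant_set I F =
     {x \<in> hyperbolic_plane.
        \<exists>t\<in>I. F t x = 0 \<and> ((\<lambda>u. F u x) has_real_derivative 0) (at t within I)}"

end

theory Submission
  imports Defs
begin

text \<open>Write \<open>p\<close>, \<open>q\<close>, \<open>r\<close> for the Lorentz products of a point \<open>x\<close> with \<open>\<gamma>\<close>, \<open>\<nu>\<close>, \<open>\<mu>\<close>. The Frenet
  equations and the Riccati equation make the \<open>t\<close>-derivative of the height function the product of
  \<open>(s - \<sigma>) (n + \<sigma> m)\<close> and a linear form in \<open>p\<close>, \<open>q\<close>, \<open>r\<close>. So \<open>x\<close> lies in the discriminant set
  iff two linear equations and \<open>- p\<^sup>2 + q\<^sup>2 + r\<^sup>2 = - 1\<close> hold at some \<open>t\<close>. The line cut out by the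
  linear equations is parallel to a lightlike direction, hence the quadric meets it
  only once, at the point of the horocyclic involute.\<close>

lemma lorentz_wedge_nth [simp]:
  "lorentz_wedge x y $ 1 = - (x $ 2 * y $ 3 - x $ 3 * y $ 2)"
  "lorentz_wedge x y $ 2 = x $ 3 * y $ 1 - x $ 1 * y $ 3"
  "lorentz_wedge x y $ 3 = x $ 1 * y $ 2 - x $ 2 * y $ 1"
  by (simp_all add: lorentz_wedge_def vector_3)

lemma bounded_linear_lorentz_left: "bounded_linear (\<lambda>y. lorentz y x)"
  by (intro linear_conv_bounded_linear[THEN iffD1] linearI)
     (simp_all add: lorentz_def algebra_simps)

lemma lorentz_linear:
  "lorentz (x + y) z = lorentz x z + lorentz y z"
  "lorentz (x - y) z = lorentz x z - lorentz y z"
  "lorentz (c *\<^sub>R x) z = c * lorentz x z"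
  "lorentz z (x + y) = lorentz z x + lorentz z y"
  "lorentz z (c *\<^sub>R x) = c * lorentz z x"
  by (simp_all add: lorentz_def algebra_simps)

lemma lorentz_commute: "lorentz x y = lorentz y x"
  by (simp add: lorentz_def mult.commute)

lemma bounded_bilinear_lorentz_wedge: "bounded_bilinear lorentz_wedge"
proof (rule bilinear_conv_bounded_bilinear[THEN iffD1])
  show "bilinear lorentz_wedge"
    unfolding bilinear_def
    by (intro conjI allI linearI) (simp_all add: vec_eq_iff forall_3 algebra_simps)
qed

text \<open>Lorentzian triple product identity, with signs opposite to the Euclidean one. It
  recovers \<gamma> and \<nu> from products with \<mu>.\<close>

lemma lorentz_wedge_wedge:
  "lorentz_wedge (lorentz_wedge x y) z = lorentz y z *\<^sub>R x - lorentz x z *\<^sub>R y"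
  by (simp add: vec_eq_iff forall_3 lorentz_def algebra_simps)

lemma lorentz_wedge_anticommute: "lorentz_wedge x y = - lorentz_wedge y x"
  by (simp add: vec_eq_iff forall_3 algebra_simps)

lemma lorentz_wedge_orthogonal [simp]:
  "lorentz (lorentz_wedge x y) x = 0" "lorentz (lorentz_wedge x y) y = 0"
  "lorentz x (lorentz_wedge x y) = 0" "lorentz y (lorentz_wedge x y) = 0"
  by (simp_all add: lorentz_def algebra_simps)

text \<open>The left-hand factors are the determinants of (a, b, x) and (a, b, y). Their product is
  minus a Gram determinant, because the metric has determinant -1; the right-hand side expands that
  determinant along its first row.\<close>

lemma lorentz_wedge_Gram:
  "lorentz (lorentz_wedge a b) x * lorentz (lorentz_wedge a b) y =
     - (lorentz a a * (lorentz b b * lorentz x y - lorentz b y * lorentz b x)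
        - lorentz a b * (lorentz a b * lorentz x y - lorentz b x * lorentz a y)
        + lorentz a x * (lorentz a b * lorentz b y - lorentz b b * lorentz a y))"
  by (simp add: lorentz_def algebra_simps)

lemma lorentz_wedge_norm:
  "lorentz (lorentz_wedge x y) (lorentz_wedge x y) = (lorentz x y)\<^sup>2 - lorentz x x * lorentz y y"
  by (simp add: lorentz_def power2_eq_square algebra_simps)

lemma lorentz_eqI:
  assumes "\<And>y. lorentz x y = lorentz x' y"
  shows "x = x'"
  using assms[of "axis 1 1"] assms[of "axis 2 1"] assms[of "axis 3 1"]
  by (simp add: lorentz_def axis_def vec_eq_iff forall_3)

context
  fixes a b :: "real ^ 3"
  assumes ab: "(a, b) \<in> Delta1"
begin

lemma Delta1_products:
  "lorentz a a = -1" "lorentz b b = 1" "lorentz a b = 0" "lorentz b a = 0" "a $ 1 > 0"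
  using ab lorentz_commute[of a b] by (auto simp: Delta1_def hyperbolic_plane_def de_Sitter_def)

text \<open>With the products of \<open>Delta1_products\<close>, the Gram identity can be solved for
  \<open>lorentz x y\<close>: a, b and their wedge form a pseudo-orthonormal basis.\<close>

lemma lorentz_frame_expansion:
  "lorentz x y = - (lorentz a x * lorentz a y) + lorentz b x * lorentz b y
     + lorentz (lorentz_wedge a b) x * lorentz (lorentz_wedge a b) y"
  using lorentz_wedge_Gram[of a b x y] Delta1_products by (simp add: algebra_simps)

lemma lorentz_wedge_square: "lorentz (lorentz_wedge a b) (lorentz_wedge a b) = 1"
  by (simp add: lorentz_wedge_norm Delta1_products)

lemma frame_eqI:
  assumes "lorentz a x = lorentz a x'" "lorentz b x = lorentz b x'"
    "lorentz (lorentz_wedge a b) x = lorentz (lorentz_wedge a b) x'"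
  shows "x = x'"
proof (rule lorentz_eqI)
  show "lorentz x y = lorentz x' y" for y
    using assms lorentz_frame_expansion[of x y] lorentz_frame_expansion[of x' y] by simp
qed

end

text \<open>Reverse Cauchy-Schwarz: points on opposite sheets of the hyperboloid have a nonnegative
  Lorentz product, so a negative one places x on the sheet of a.\<close>

lemma hyperbolic_plane_sheet:
  assumes a: "a \<in> hyperbolic_plane" and x: "lorentz x x = -1" and ax: "lorentz a x < 0"
  shows "x \<in> hyperbolic_plane"
proof (rule ccontr)
  assume "x \<notin> hyperbolic_plane"
  with x have x1: "x $ 1 \<le> 0" by (auto simp: hyperbolic_plane_def)
  have sq: "(a $ 1)\<^sup>2 = 1 + (a $ 2)\<^sup>2 + (a $ 3)\<^sup>2" "(x $ 1)\<^sup>2 = 1 + (x $ 2)\<^sup>2 + (x $ 3)\<^sup>2"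
    using a x by (auto simp: hyperbolic_plane_def lorentz_def power2_eq_square)
  have "- (a $ 2 * x $ 2 + a $ 3 * x $ 3) \<le> a $ 1 * - x $ 1"
  proof (rule power2_le_imp_le)
    \<comment> \<open>Lagrange's identity for the spatial parts, whose squared Euclidean norms are
      given by \<open>sq\<close>.\<close>
    have "(a $ 2 * x $ 2 + a $ 3 * x $ 3)\<^sup>2 + (a $ 2 * x $ 3 - a $ 3 * x $ 2)\<^sup>2
      = ((a $ 1)\<^sup>2 - 1) * ((x $ 1)\<^sup>2 - 1)"
      unfolding sq by algebra
    also have "\<dots> \<le> (a $ 1)\<^sup>2 * (x $ 1)\<^sup>2"
      unfolding sq by (intro mult_mono) auto
    finally show "(- (a $ 2 * x $ 2 + a $ 3 * x $ 3))\<^sup>2 \<le> (a $ 1 * - x $ 1)\<^sup>2"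
      using zero_le_power2[of "a $ 2 * x $ 3 - a $ 3 * x $ 2"]
      by (simp only: power_mult_distrib power2_minus)
    show "0 \<le> a $ 1 * - x $ 1"
      using a x1 by (intro mult_nonneg_nonneg) (auto simp: hyperbolic_plane_def)
  qed
  with ax show False by (simp add: lorentz_def)
qed

text \<open>The third Frenet equation: the Leibniz rule for the wedge leaves \<mu> \<and> \<nu> =
  \<gamma> and \<gamma> \<and> \<mu> = -\<nu>.\<close>

lemma Legendre_frame_mu_derivative:
  assumes "(\<gamma> t, \<nu> t) \<in> Delta1"
    and "(\<gamma> has_vector_derivative m *\<^sub>R frame_mu \<gamma> \<nu> t) (at t within I)"
    and "(\<nu> has_vector_derivative n *\<^sub>R frame_mu \<gamma> \<nu> t) (at t within I)"
  shows "(frame_mu \<gamma> \<nu> has_vector_derivative m *\<^sub>R \<gamma> t - n *\<^sub>R \<nu> t) (at t within I)"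
proof -
  let ?\<mu> = "frame_mu \<gamma> \<nu> t"
  interpret wedge: bounded_bilinear lorentz_wedge by (rule bounded_bilinear_lorentz_wedge)
  have "((\<lambda>u. lorentz_wedge (\<gamma> u) (\<nu> u)) has_vector_derivative
      lorentz_wedge (\<gamma> t) (n *\<^sub>R ?\<mu>) + lorentz_wedge (m *\<^sub>R ?\<mu>) (\<nu> t)) (at t within I)"
    using assms(2,3) by (rule wedge.has_vector_derivative)
  moreover have "lorentz_wedge ?\<mu> (\<nu> t) = \<gamma> t" "lorentz_wedge (\<gamma> t) ?\<mu> = - \<nu> t"
    by (simp_all add: frame_mu_def lorentz_wedge_wedge Delta1_products[OF assms(1)]
        lorentz_wedge_anticommute[of "\<gamma> t" "lorentz_wedge (\<gamma> t) (\<nu> t)"])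
  ultimately show ?thesis
    by (simp add: frame_mu_def[abs_def] wedge.scaleR_left wedge.scaleR_right)
qed

lemma H_I_frame:
  "H_I \<sigma> \<gamma> \<nu> s t x =
     (1 - \<sigma> * s t + (s t)\<^sup>2 / 2) * lorentz (\<gamma> t) x
     + (s t - \<sigma>) * lorentz (frame_mu \<gamma> \<nu> t) x
     + (\<sigma> * (s t)\<^sup>2 / 2 - s t) * lorentz (\<nu> t) x + 1"
  by (simp add: H_I_def lorentz_linear algebra_simps)

lemma H_I_derivative:
  assumes \<sigma>: "\<sigma> = 1 \<or> \<sigma> = -1" and t: "t \<in> I"
    and L: "spacelike_Legendre_curve I \<gamma> \<nu>" and C: "Legendre_curvature I \<gamma> \<nu> m n"
    and R: "Riccati_solution \<sigma> I m n s"
  shows "((\<lambda>u. H_I \<sigma> \<gamma> \<nu> s u x) has_real_derivative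
     (s t - \<sigma>) * (n t + \<sigma> * m t) *
       (\<sigma> * (s t)\<^sup>2 / 2 * lorentz (\<gamma> t) x + \<sigma> * s t * lorentz (frame_mu \<gamma> \<nu> t) x
        + ((s t)\<^sup>2 / 2 - 1) * lorentz (\<nu> t) x)) (at t within I)"
proof -
  have \<gamma>': "(\<gamma> has_vector_derivative m t *\<^sub>R frame_mu \<gamma> \<nu> t) (at t within I)"
    and \<nu>': "(\<nu> has_vector_derivative n t *\<^sub>R frame_mu \<gamma> \<nu> t) (at t within I)"
    using C t by (auto simp: Legendre_curvature_def)
  have D: "(\<gamma> t, \<nu> t) \<in> Delta1"
    using L t by (auto simp: spacelike_Legendre_curve_def)
  define s' where "s' = (m t + \<sigma> * n t) / 2 * (s t)\<^sup>2 - m t"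
  define p q r where "p = lorentz (\<gamma> t) x" and "q = lorentz (\<nu> t) x"
    and "r = lorentz (frame_mu \<gamma> \<nu> t) x"
  have sd: "(s has_real_derivative s') (at t within I)"
    using R t by (auto simp: Riccati_solution_def s'_def)
  have frame': "((\<lambda>u. lorentz (v u) x) has_real_derivative lorentz v' x) (at t within I)"
    if "(v has_vector_derivative v') (at t within I)" for v v'
    using bounded_linear.has_vector_derivative[OF bounded_linear_lorentz_left that]
    by (simp add: has_real_derivative_iff_has_vector_derivative)
  note d = frame'[OF \<gamma>'] frame'[OF \<nu>'] frame'[OF Legendre_frame_mu_derivative[OF D \<gamma>' \<nu>']]
  have "((\<lambda>u. H_I \<sigma> \<gamma> \<nu> s u x) has_real_derivative
      (- \<sigma> * s' + s t * s') * p + (1 - \<sigma> * s t + (s t)\<^sup>2 / 2) * (m t * r)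
      + s' * r + (s t - \<sigma>) * (m t * p - n t * q)
      + (\<sigma> * (s t) * s' - s') * q + (\<sigma> * (s t)\<^sup>2 / 2 - s t) * (n t * r)) (at t within I)"
    unfolding H_I_frame
    \<comment> \<open>\<open>zero_neq_numeral\<close> settles the side condition that the
      denominator 2 is nonzero.\<close>
    apply (rule derivative_eq_intros d sd refl zero_neq_numeral[symmetric])+
    by (simp add: lorentz_linear p_def q_def r_def algebra_simps)
  \<comment> \<open>Inserting the Riccati equation for \<open>s'\<close> and using \<sigma>^2 = 1
    factors each of the coefficients of p, q and r.\<close>
  also have "?this \<longleftrightarrow> ?thesis"
    using \<sigma> by (intro arg_cong[where f = "\<lambda>d. (_ has_real_derivative d) _"])
      (auto simp: s'_def p_def q_def r_def field_simps power2_eq_square)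
  finally show ?thesis .
qed

text \<open>The solution is unique because the quadratic terms cancel after elimination of \<open>r\<close> and \<open>q\<close>
  in favour of \<open>p + \<sigma> q\<close>.\<close>

lemma involute_coordinates:
  fixes p q r s \<sigma> :: real
  assumes \<sigma>: "\<sigma> = 1 \<or> \<sigma> = -1"
    and height: "(1 - \<sigma> * s + s\<^sup>2 / 2) * p + (s - \<sigma>) * r + (\<sigma> * s\<^sup>2 / 2 - s) * q + 1 = 0"
    and slope: "\<sigma> * s\<^sup>2 / 2 * p + \<sigma> * s * r + (s\<^sup>2 / 2 - 1) * q = 0"
    and quadric: "- (p * p) + q * q + r * r = -1"
  shows "p = - (1 + s\<^sup>2 / 2)" "q = \<sigma> * s\<^sup>2 / 2" "r = s"
proof -
  define u where "u = p + \<sigma> * q"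
  \<comment> \<open>In \<open>height\<close> minus \<sigma> times \<open>slope\<close> the terms in
    s^2 cancel, and p and q enter only through u.\<close>
  have r: "r = \<sigma> + (\<sigma> - s) * u"
    using \<sigma> height slope by (auto simp: u_def field_simps)
  have "\<sigma> * q = s\<^sup>2 / 2 * u + s * r"
    using \<sigma> slope by (auto simp: u_def field_simps)
  then have q: "\<sigma> * q = \<sigma> * s + (\<sigma> * s - s\<^sup>2 / 2) * u"
    by (simp add: r algebra_simps power2_eq_square)
  \<comment> \<open>Here -p^2 + q^2 = -(p + \<sigma> q)(p - \<sigma> q), and p - \<sigma> q = u - 2
    \<sigma> q.\<close>
  have "- (u * u) + 2 * u * (\<sigma> * q) + r * r = -1"
    using \<sigma> quadric by (auto simp: u_def algebra_simps)
  \<comment> \<open>After substitution the equation reads 2 u + 1 = -1.\<close>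
  then have u: "u = -1"
    unfolding q r using \<sigma> by (auto simp: algebra_simps power2_eq_square)
  from r q u show "r = s" "q = \<sigma> * s\<^sup>2 / 2"
    using \<sigma> by (auto simp: algebra_simps)
  then show "p = - (1 + s\<^sup>2 / 2)"
    using u \<sigma> by (auto simp: u_def algebra_simps)
qed

lemma horocyclic_involute_coordinates:
  assumes "(\<gamma> t, \<nu> t) \<in> Delta1"
  shows "lorentz (\<gamma> t) (horocyclic_involute \<sigma> \<gamma> \<nu> s t) = - (1 + (s t)\<^sup>2 / 2)"
    and "lorentz (\<nu> t) (horocyclic_involute \<sigma> \<gamma> \<nu> s t) = \<sigma> * (s t)\<^sup>2 / 2"
    and "lorentz (frame_mu \<gamma> \<nu> t) (horocyclic_involute \<sigma> \<gamma> \<nu> s t) = s t"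
  by (simp_all add: horocyclic_involute_def lorentz_linear Delta1_products[OF assms] frame_mu_def
      lorentz_wedge_square[OF assms])

text \<open>The frame coordinates give -(1 + s^2/2)^2 + (s^2/2)^2 + s^2 = -1, and the negative
  product with \<gamma> selects the sheet.\<close>

lemma horocyclic_involute_in_hyperbolic_plane:
  assumes D: "(\<gamma> t, \<nu> t) \<in> Delta1" and \<sigma>: "\<sigma> = 1 \<or> \<sigma> = -1"
  shows "horocyclic_involute \<sigma> \<gamma> \<nu> s t \<in> hyperbolic_plane"
proof (rule hyperbolic_plane_sheet)
  note coords = horocyclic_involute_coordinates[of \<gamma> t \<nu> \<sigma> s, OF D]
  show "\<gamma> t \<in> hyperbolic_plane"
    using D by (auto simp: Delta1_def)
  show "lorentz (horocyclic_involute \<sigma> \<gamma> \<nu> s t) (horocyclic_involute \<sigma> \<gamma> \<nu> s t) = -1"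
    using \<sigma> lorentz_frame_expansion[OF D, of "horocyclic_involute \<sigma> \<gamma> \<nu> s t"
        "horocyclic_involute \<sigma> \<gamma> \<nu> s t", folded frame_mu_def[of \<gamma> \<nu> t], unfolded coords]
    by (auto simp: field_simps power2_eq_square)
  show "lorentz (\<gamma> t) (horocyclic_involute \<sigma> \<gamma> \<nu> s t) < 0"
    using zero_le_power2[of "s t"] by (simp only: coords)
qed

text \<open>The claim at a fixed t, with the linear form in place of the derivative. Conversely, the
  two equations and the quadric fix all three frame coordinates of x, hence x.\<close>

lemma eq_horocyclic_involute_iff:
  assumes D: "(\<gamma> t, \<nu> t) \<in> Delta1" and \<sigma>: "\<sigma> = 1 \<or> \<sigma> = -1" and x: "x \<in> hyperbolic_plane"
  shows "x = horocyclic_involute \<sigma> \<gamma> \<nu> s t \<longleftrightarrow>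
    H_I \<sigma> \<gamma> \<nu> s t x = 0 \<and>
    \<sigma> * (s t)\<^sup>2 / 2 * lorentz (\<gamma> t) x + \<sigma> * s t * lorentz (frame_mu \<gamma> \<nu> t) x
      + ((s t)\<^sup>2 / 2 - 1) * lorentz (\<nu> t) x = 0"
    (is "?eq \<longleftrightarrow> ?height \<and> ?slope")
proof
  assume ?eq
  then show "?height \<and> ?slope"
    using \<sigma> by (auto simp: H_I_frame horocyclic_involute_coordinates[of \<gamma> t \<nu> \<sigma> s, OF D] field_simps power2_eq_square)
next
  assume hs: "?height \<and> ?slope"
  have "- (lorentz (\<gamma> t) x * lorentz (\<gamma> t) x) + lorentz (\<nu> t) x * lorentz (\<nu> t) x
     + lorentz (frame_mu \<gamma> \<nu> t) x * lorentz (frame_mu \<gamma> \<nu> t) x = -1"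
    using x lorentz_frame_expansion[OF D, of x x] by (simp add: hyperbolic_plane_def frame_mu_def)
  note coords = involute_coordinates[OF \<sigma> hs[THEN conjunct1, unfolded H_I_frame]
      hs[THEN conjunct2] this]
  show ?eq
    by (rule frame_eqI[OF D])
      (simp_all only: coords horocyclic_involute_coordinates[of \<gamma> t \<nu> \<sigma> s, OF D]
        frame_mu_def[of \<gamma> \<nu> t, symmetric])
qed

theorem proposition4p8:
  fixes I :: "real set"
    and \<gamma> \<nu> :: "real \<Rightarrow> real ^ 3"
    and m n s :: "real \<Rightarrow> real"
    and \<sigma> :: real
  assumes "is_interval I" and "interior I \<noteq> {}"
    and "\<sigma> = 1 \<or> \<sigma> = -1"
    and "spacelike_Legendre_curve I \<gamma> \<nu>"
    and "Legendre_curvature I \<gamma> \<nu> m n"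
    and "I \<subseteq> closure {t \<in> I. n t \<noteq> 0}"
    and "Riccati_solution \<sigma> I m n s"
    and "\<forall>t\<in>I. (s t - \<sigma>) * (n t + \<sigma> * m t) \<noteq> 0"
  shows "horocyclic_involute \<sigma> \<gamma> \<nu> s ` I = discriminant_set I (H_I \<sigma> \<gamma> \<nu> s)"
proof -
  have D: "(\<gamma> t, \<nu> t) \<in> Delta1" if "t \<in> I" for t
    using assms(4) that by (auto simp: spacelike_Legendre_curve_def)
  \<comment> \<open>A derivative within I is unique only at limit points of I. A connected set that
    is not a singleton consists of limit points, and a singleton has empty interior.\<close>
  have limit: "at t within I \<noteq> bot" if "t \<in> I" for t
  proof -
    have "I \<noteq> {y}" for y using assms(2) by auto
    then show ?thesis
      using connected_imp_perfect[OF is_interval_connected[OF assms(1)] that]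
      by (auto simp: trivial_limit_within)
  qed
  have "x = horocyclic_involute \<sigma> \<gamma> \<nu> s t \<longleftrightarrow>
      H_I \<sigma> \<gamma> \<nu> s t x = 0 \<and> ((\<lambda>u. H_I \<sigma> \<gamma> \<nu> s u x) has_real_derivative 0) (at t within I)"
    if "t \<in> I" "x \<in> hyperbolic_plane" for t x
  proof -
    note der = H_I_derivative[OF assms(3) that(1) assms(4,5,7), of x]
    have "((\<lambda>u. H_I \<sigma> \<gamma> \<nu> s u x) has_real_derivative 0) (at t within I) \<longleftrightarrow>
      \<sigma> * (s t)\<^sup>2 / 2 * lorentz (\<gamma> t) x + \<sigma> * s t * lorentz (frame_mu \<gamma> \<nu> t) x
        + ((s t)\<^sup>2 / 2 - 1) * lorentz (\<nu> t) x = 0" (is "_ \<longleftrightarrow> ?slope = 0")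
    proof
      assume "((\<lambda>u. H_I \<sigma> \<gamma> \<nu> s u x) has_real_derivative 0) (at t within I)"
      \<comment> \<open>By uniqueness the computed derivative is 0; its first two factors are
        nonzero by hypothesis, which leaves the linear form.\<close>
      then have "(s t - \<sigma>) * (n t + \<sigma> * m t) * ?slope = 0"
        using der limit[OF that(1)]
        by (metis has_real_derivative_iff_has_vector_derivative vector_derivative_unique_within)
      then show "?slope = 0" using assms(8) that(1) by (metis mult_eq_0_iff)
    qed (use der in simp)
    then show ?thesis
      using eq_horocyclic_involute_iff[of \<gamma> t \<nu> \<sigma> x s] D[OF that(1)] assms(3) that(2) by blast
  qed
  then show ?thesis
    using horocyclic_involute_in_hyperbolic_plane[of \<gamma> _ \<nu>] D assms(3)
    by (fastforce simp: discriminant_set_def image_iff)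
qed

end
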